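(* For any connected graph $G$ of order $n\ge 2$ and for any positive integer $k$, $1\le \gamma_L^k(G)\le n-1$.
   Context: All graphs are finite, simple, undirected and connected. $d(x,y)$ is the length of a shortest path between $x$ and $y$ in $G$. For a positive integer $k$, let $d_k(x,y)=\min\{d(x,y),k+1\}$. A set $D\subseteq V(G)$ is a distance-$k$ dominating set of $G$ if for each $u\in V(G)\setminus D$ there is $w\in D$ with $d(u,w)\le k$. A set $S\subseteq V(G)$ is a distance-$k$ resolving set of $G$ if for any distinct $x,y\in V(G)$ there is $z\in S$ with $d_k(x,z)\ne d_k(y,z)$. A distance-$k$ locating-dominating set of $G$ is a set $S\subseteq V(G)$ that is both a distance-$k$ dominating set and a distance-$k$ resolving set of $G$; the distance-$k$ location-domination number $\gamma_L^k(G)$ is the minimum cardinality of such a set. *)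

theory Defs
  imports "Graph_Theory.Digraph_Component" "Graph_Theory.Shortest_Path"
begin

text \<open>
  Finite simple undirected graphs are the symmetric digraphs of locale \<open>graph\<close>: each edge is
  a pair of opposite arcs. Costs are attached to arcs, so with unit cost a walk costs its length and
  \<open>\<mu>\<close> (an infimum over walks, of type \<^typ>\<open>ereal\<close>) is the length of a shortest path.
\<close>

definition graph_dist :: "('a, 'b) pre_digraph \<Rightarrow> 'a \<Rightarrow> 'a \<Rightarrow> ereal" where
  "graph_dist G x y = wf_digraph.\<mu> G (\<lambda>_. 1) x y"

definition trunc_dist :: "('a, 'b) pre_digraph \<Rightarrow> nat \<Rightarrow> 'a \<Rightarrow> 'a \<Rightarrow> ereal" where
  "trunc_dist G k x y = min (graph_dist G x y) (ereal (real (k + 1)))"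

definition dist_dominating :: "('a, 'b) pre_digraph \<Rightarrow> nat \<Rightarrow> 'a set \<Rightarrow> bool" where
  "dist_dominating G k D \<longleftrightarrow>
     D \<subseteq> verts G \<and> (\<forall>u \<in> verts G - D. \<exists>w \<in> D. graph_dist G u w \<le> ereal (real k))"

definition dist_resolving :: "('a, 'b) pre_digraph \<Rightarrow> nat \<Rightarrow> 'a set \<Rightarrow> bool" where
  "dist_resolving G k S \<longleftrightarrow>
     S \<subseteq> verts G \<and>
     (\<forall>x \<in> verts G. \<forall>y \<in> verts G. x \<noteq> y \<longrightarrow>
        (\<exists>z \<in> S. trunc_dist G k x z \<noteq> trunc_dist G k y z))"

definition dist_locating_dominating :: "('a, 'b) pre_digraph \<Rightarrow> nat \<Rightarrow> 'a set \<Rightarrow> bool" where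
  "dist_locating_dominating G k S \<longleftrightarrow> dist_dominating G k S \<and> dist_resolving G k S"

definition location_domination_number :: "('a, 'b) pre_digraph \<Rightarrow> nat \<Rightarrow> nat" where
  "location_domination_number G k =
     (LEAST m. \<exists>S. dist_locating_dominating G k S \<and> card S = m)"

end

(* The complement of any single vertex v is distance-k locating-dominating: v has a neighbour
   because G is connected with at least two vertices, and of two distinct vertices at least one
   lies in the complement and resolves the pair, being the only vertex at distance 0 from itself. *)
theory Submission
  imports Defs
begin

lemma (in wf_digraph) graph_dist_self:
  assumes "u \<in> verts G"
  shows "graph_dist G u u = 0"
proof (rule antisym)
  show "graph_dist G u u \<le> 0"
    using min_cost_le_walk_cost[of u "[]" u "\<lambda>_. 1"] assms
    by (simp add: graph_dist_def awalk_Nil_iff zero_ereal_def)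
next
  show "0 \<le> graph_dist G u u"
    unfolding graph_dist_def \<mu>_def
    by (auto intro!: INF_greatest pos_cost_pos_awalk_cost)
qed

text \<open>A walk between distinct vertices is nonempty, so its first arc already costs 1 and the
  remaining walk costs at least 0. The bound passes to the infimum, which is infinite if there is no
  walk.\<close>

lemma (in wf_digraph) graph_dist_ge_1:
  assumes "u \<noteq> v"
  shows "1 \<le> graph_dist G u v"
  unfolding graph_dist_def \<mu>_def
proof (rule INF_greatest)
  fix p assume "p \<in> {p. awalk u p v}"
  then have "awalk u p v" by simp
  then obtain e es where "p = e # es" "awalk (head G e) es v"
    using assms by (cases p) (auto simp: awalk_Nil_iff awalk_Cons_iff)
  then show "1 \<le> ereal (awalk_cost (\<lambda>_. 1) p)"
    using pos_cost_pos_awalk_cost[of "head G e" es v "\<lambda>_. 1"] by (simp add: one_ereal_def)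
qed

lemma (in wf_digraph) graph_dist_adj_le_1:
  assumes "u \<rightarrow> v"
  shows "graph_dist G u v \<le> 1"
proof -
  obtain e where "e \<in> arcs G" "tail G e = u" "head G e = v"
    using assms by (auto simp: arcs_ends_conv)
  then have "awalk u [e] v"
    using arc_implies_awalk by blast
  from min_cost_le_walk_cost[OF this, of "\<lambda>_. 1"] show ?thesis
    by (simp add: graph_dist_def one_ereal_def)
qed

text \<open>The cap \<open>k + 1\<close> is at least 1, so truncation keeps the value 0 apart from
  every distance that is at least 1.\<close>

lemma (in wf_digraph) trunc_dist_self_neq:
  assumes "u \<in> verts G" "u \<noteq> v"
  shows "trunc_dist G k u u \<noteq> trunc_dist G k v u"
proof -
  have "trunc_dist G k u u = 0"
    using assms by (simp add: trunc_dist_def graph_dist_self min_def)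
  moreover have "1 \<le> trunc_dist G k v u"
    using graph_dist_ge_1[of v u] assms by (simp add: trunc_dist_def one_ereal_def)
  ultimately show ?thesis by auto
qed

lemma (in wf_digraph) dist_resolving_minus_vertex:
  "dist_resolving G k (verts G - {v})"
  unfolding dist_resolving_def
proof (intro conjI ballI impI)
  fix x y assume "x \<in> verts G" "y \<in> verts G" "x \<noteq> y"
  show "\<exists>z\<in>verts G - {v}. trunc_dist G k x z \<noteq> trunc_dist G k y z"
  \<comment> \<open>Only \<open>v\<close> is missing from the set, so \<open>y\<close> serves as the
    resolving vertex if \<open>x = v\<close>, and \<open>x\<close> otherwise.\<close>
  proof (cases "x = v")
    case True
    then show ?thesis
      using trunc_dist_self_neq[of y x k] \<open>y \<in> verts G\<close> \<open>x \<noteq> y\<close> by (intro bexI[of _ y]) auto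
  next
    case False
    then show ?thesis
      using trunc_dist_self_neq[of x y k] \<open>x \<in> verts G\<close> \<open>x \<noteq> y\<close> by (intro bexI[of _ x]) auto
  qed
qed auto

lemma (in graph) dist_locating_dominating_minus_vertex:
  assumes "connected G" "v \<in> verts G" "card (verts G) \<ge> 2" "k \<ge> 1"
  shows "dist_locating_dominating G k (verts G - {v})"
proof -
  have "\<not> verts G \<subseteq> {v}"
    using assms(3) card_mono[of "{v}" "verts G"] by auto
  then obtain u where u: "u \<in> verts G" "u \<noteq> v" by blast
  have "v \<rightarrow>\<^sup>* u"
    using symmetric_connected_imp_strongly_connected[OF sym_arcs assms(1)] assms(2) u(1) by auto
  \<comment> \<open>As \<open>u\<close> differs from \<open>v\<close>, the walk from
    \<open>v\<close> to \<open>u\<close> has a first arc; its head is the neighbour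
    \<open>w\<close>, which differs from \<open>v\<close> because there are no loops.\<close>
  then obtain w where w: "v \<rightarrow> w"
    using u(2) by (cases rule: converse_reachable_cases) auto
  then have "w \<in> verts G - {v}"
    using adj_in_verts adj_not_same by auto
  moreover have "graph_dist G v w \<le> ereal (real k)"
    using graph_dist_adj_le_1[OF w] assms(4)
    by (auto simp: one_ereal_def intro: order_trans)
  ultimately have "dist_dominating G k (verts G - {v})"
    by (auto simp: dist_dominating_def)
  then show ?thesis
    by (simp add: dist_locating_dominating_def dist_resolving_minus_vertex)
qed

text \<open>The empty set cannot dominate any vertex. Finiteness of \<open>S\<close> matters too,
  since \<open>card\<close> is 0 on infinite sets.\<close>

lemma (in fin_digraph) dist_locating_dominating_card_pos:
  assumes "dist_locating_dominating G k S" "verts G \<noteq> {}"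
  shows "1 \<le> card S"
proof -
  have "dist_dominating G k S"
    using assms(1) by (simp add: dist_locating_dominating_def)
  then have "finite S" "S \<noteq> {}"
    using assms(2) by (auto simp: dist_dominating_def intro: finite_subset)
  then show ?thesis
    by (simp add: Suc_le_eq card_gt_0_iff)
qed

theorem corollary3p2:
  fixes G :: "('a, 'b) pre_digraph" and n k :: nat
  assumes "graph G"
    and "Digraph_Component.connected G"
    and "card (verts G) = n"
    and "n \<ge> 2"
    and "k \<ge> 1"
  shows "1 \<le> location_domination_number G k \<and> location_domination_number G k \<le> n - 1"
proof -
  interpret graph G by fact
  have ne: "verts G \<noteq> {}" using assms(3,4) by auto
  then obtain v where "v \<in> verts G" by blast
  let ?P = "\<lambda>m. \<exists>S. dist_locating_dominating G k S \<and> card S = m"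
  have P: "?P (n - 1)"
    using dist_locating_dominating_minus_vertex[of v k] \<open>v \<in> verts G\<close> assms
    by (intro exI[of _ "verts G - {v}"]) auto
  \<comment> \<open>The witness \<open>n - 1\<close> ensures that the \<open>LEAST\<close> is
    attained, so the lower bound for arbitrary locating-dominating sets applies to a minimum
    one.\<close>
  have "?P (location_domination_number G k)"
    unfolding location_domination_number_def by (rule LeastI[of ?P, OF P])
  then have "1 \<le> location_domination_number G k"
    using dist_locating_dominating_card_pos[OF _ ne] by metis
  moreover have "location_domination_number G k \<le> n - 1"
    unfolding location_domination_number_def by (rule Least_le[of ?P, OF P])
  ultimately show ?thesis ..
qed

end
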